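(* Let $P(X) \in \mathbb{R}[X]$ be a polynomial of degree $k \geq 2$ with positive leading coefficient. Then there is a polynomial $f(X) \in \mathbb{R}[X]$ of degree $k-1$, depending on $P$, with the following property: for every $i_0 \in \mathbb{R}$ such that $P(x) > 0$ for all real $x > i_0$, there is an integer $N_0$ (depending on $f$ and $i_0$) such that, with $x_i = \frac{1}{P(i+i_0)}$ for integers $i \geq 1$, \[ f(n+i_0) < \frac{1}{\sum_{i=n+1}^{\infty} x_i} < f(n+i_0)+1 \] holds for all integers $n \geq N_0$ with $n \geq 0$. Moreover, $f$ is unique up to the constant term: any two real polynomials of degree $k-1$ having this property differ by a constant. *)

theory Defs
  imports Complex_Main "HOL-Computational_Algebra.Polynomial"
begin

definition recip_seq :: "real poly \<Rightarrow> real \<Rightarrow> nat \<Rightarrow> real" where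
  "recip_seq P i\<^sub>0 i = 1 / poly P (real i + i\<^sub>0)"

text \<open>
  The tail sum over all \<open>i \<ge> n + 1\<close> is written with the summation index shifted by \<open>n + 1\<close>.
  The value \<open>i\<^sub>0\<close> is quantified after \<open>f\<close>: one and the same \<open>f\<close> has to work for
  every admissible \<open>i\<^sub>0\<close>.
\<close>

definition approximates_recip_tails :: "real poly \<Rightarrow> real poly \<Rightarrow> bool" where
  "approximates_recip_tails P f \<longleftrightarrow>
     (\<forall>i\<^sub>0::real. (\<forall>x>i\<^sub>0. poly P x > 0) \<longrightarrow>
       (\<exists>N\<^sub>0::int. \<forall>n::nat. int n \<ge> N\<^sub>0 \<longrightarrow>
          poly f (real n + i\<^sub>0) < 1 / (\<Sum>j. recip_seq P i\<^sub>0 (n + 1 + j)) \<and>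
          1 / (\<Sum>j. recip_seq P i\<^sub>0 (n + 1 + j)) < poly f (real n + i\<^sub>0) + 1))"

end

(* Writing T(y) for the sum of 1 / P(y + j) over j >= 1, a polynomial g tending to infinity
   satisfies 1 / T(y) > g(y) for large y as soon as 1 / g(y) - 1 / g(y+1) > 1 / P(y+1) for large y,
   by telescoping; likewise with both inequalities reversed.  After clearing denominators, the sign
   of the defect D(g) = (g(y+1) - g(y)) P(y+1) - g(y) g(y+1) decides.  The coefficients of g can be
   chosen successively, from the top down, so that D(g) has degree less than k - 1.  Replacing g by
   g + e then adds a multiple -2 e lc(g) of the power y^(k-1), which dominates, so g - 1/2 and
   g + 1/2 lie on different sides of 1 / T.  Uniqueness holds because a polynomial that is bounded
   along a sequence i0 + n is constant. *)
theory Submission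
  imports Defs
begin

section \<open>Coefficients and growth of real polynomials\<close>

lemma coeff_mult_degree_le_sum:
  fixes p q :: "'a::comm_semiring_0 poly"
  assumes "degree p \<le> m" "degree q \<le> n"
  shows "coeff (p * q) (m + n) = coeff p m * coeff q n"
proof -
  have "(\<Sum>i\<le>m + n. coeff p i * coeff q (m + n - i)) =
        (\<Sum>i\<in>{m}. coeff p i * coeff q (m + n - i))"
  proof (rule sum.mono_neutral_right)
    show "\<forall>i\<in>{..m + n} - {m}. coeff p i * coeff q (m + n - i) = 0"
    proof
      fix i assume "i \<in> {..m + n} - {m}"
      then consider "i > m" | "m + n - i > n" by fastforce
      then show "coeff p i * coeff q (m + n - i) = 0"
        using assms by cases (simp_all add: coeff_eq_0)
    qed
  qed auto
  then show ?thesis by (simp add: coeff_mult)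
qed

text \<open>Stated for a degree bound \<open>n\<close>, since for a defect only such a bound and one
  coefficient are known; positivity of that coefficient makes \<open>n\<close> the exact
  degree.\<close>

lemma eventually_poly_pos:
  fixes p :: "real poly"
  assumes "degree p \<le> n" "coeff p n > 0"
  shows "\<forall>\<^sub>F x in at_top. poly p x > 0"
proof -
  have "degree p = n"
    using assms le_degree[of p n] by simp
  then have lc: "lead_coeff p > 0" using assms by simp
  then obtain a where "\<forall>x\<ge>a. poly p x \<ge> lead_coeff p"
    using poly_pinfty_gt_lc by blast
  then show ?thesis
    unfolding eventually_at_top_linorder using lc by (meson less_le_trans)
qed

lemma filterlim_poly_at_top:
  fixes p :: "real poly"
  assumes "degree p > 0" "lead_coeff p > 0"
  shows "filterlim (poly p) at_top at_top"
  unfolding filterlim_at_top_dense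
proof
  fix c :: real
  have "\<forall>\<^sub>F x in at_top. poly (p - [:c:]) x > 0"
    using assms by (intro eventually_poly_pos[of _ "degree p"])
      (auto intro!: degree_diff_le simp: coeff_pCons split: nat.splits)
  then show "\<forall>\<^sub>F x in at_top. c < poly p x" by simp
qed

lemma degree_eq_0_if_abs_bounded:
  fixes h :: "real poly"
  assumes "\<forall>\<^sub>F n in sequentially. \<bar>poly h (real n + a)\<bar> < c"
  shows "degree h = 0"
proof (rule ccontr)
  assume deg: "degree h \<noteq> 0"
  have lim: "filterlim (\<lambda>n. real n + a) at_top sequentially"
    using filterlim_tendsto_add_at_top[OF tendsto_const filterlim_real_sequentially, of a]
    by (simp add: add.commute)
  \<comment> \<open>Only an upper bound is assumed, so the claim applies to whichever of
    \<open>h\<close> and \<open>- h\<close> has positive leading coefficient.\<close>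
  have *: False if "lead_coeff q > 0" "degree q > 0"
      "\<forall>\<^sub>F n in sequentially. poly q (real n + a) < c" for q
  proof -
    have "\<forall>\<^sub>F n in sequentially. poly q (real n + a) > c"
      using filterlim_compose[OF filterlim_poly_at_top[OF that(2,1)] lim]
      by (simp add: filterlim_at_top_dense)
    with that(3) have "\<forall>\<^sub>F n in sequentially. False" by eventually_elim simp
    then show False by simp
  qed
  have "lead_coeff h \<noteq> 0" using deg by auto
  then consider "lead_coeff h > 0" | "lead_coeff (- h) > 0" by fastforce
  then show False
  proof cases
    case 1
    then show False
      using deg assms by (intro *[of h]) (auto elim: eventually_mono)
  next
    case 2
    then show False
      using deg assms by (intro *[of "- h"]) (auto elim: eventually_mono)
  qed
qed

section \<open>The shift by one and forward differences\<close>

abbreviation shift :: "real poly \<Rightarrow> real poly" where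
  "shift p \<equiv> pcompose p [:1, 1:]"

lemma poly_shift: "poly (shift p) x = poly p (x + 1)"
  by (simp add: poly_pcompose add.commute)

lemma degree_shift: "degree (shift p) = degree p"
  by (simp add: degree_pcompose)

lemma coeff_shift_top:
  assumes "degree p \<le> n"
  shows "coeff (shift p) n = coeff p n"
proof (cases "degree p = n")
  case True
  then show ?thesis
    using lead_coeff_comp[of "[:1, 1:]" p] by (simp add: degree_shift)
next
  case False
  then show ?thesis
    using assms by (simp add: coeff_eq_0 degree_shift)
qed

lemma shift_monom: "shift (monom c d) = smult c ([:1, 1:] ^ d)"
  by (induction d) (simp_all add: monom_0 monom_Suc pcompose_pCons)

text \<open>The top terms cancel, and the binomial theorem gives the next one, as for a
  derivative.\<close>

lemma diff_shift_monom_Suc: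
  fixes c :: real and d :: nat
  defines "q \<equiv> shift (monom c (Suc d)) - monom c (Suc d)"
  shows "degree q \<le> d" and "coeff q d = real (Suc d) * c"
proof -
  have "coeff q i = 0" if "i > d" for i
  proof (cases "i = Suc d")
    case True
    then show ?thesis
      by (simp only: q_def coeff_diff) (simp add: coeff_shift_top degree_monom_le)
  next
    case False
    then have "i > Suc d" using that by simp
    then show ?thesis
      by (auto simp add: q_def degree_shift intro!: coeff_eq_0 le_less_trans[OF degree_monom_le])
  qed
  then show "degree q \<le> d" by (simp add: degree_le)
  show "coeff q d = real (Suc d) * c"
    unfolding q_def coeff_diff shift_monom coeff_smult
    by (subst coeff_linear_poly_power) (simp_all add: binomial_Suc_n)
qed

section \<open>The defect and how it reacts to a single coefficient\<close>

definition defect :: "real poly \<Rightarrow> real poly \<Rightarrow> real poly" where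
  "defect P g = (shift g - g) * shift P - g * shift g"

lemma poly_defect:
  "poly (defect P g) y =
     (poly g (y + 1) - poly g y) * poly P (y + 1) - poly g y * poly g (y + 1)"
  by (simp add: defect_def poly_shift)

lemma defect_0: "defect P 0 = 0"
  by (simp add: defect_def)

lemma defect_add:
  "defect P (g + h) = defect P g +
     ((shift h - h) * shift P - (h * shift g + g * shift h) - h * shift h)"
  by (simp add: defect_def pcompose_add algebra_simps)

text \<open>The difference term has degree one less than \<open>d\<close>, which the factor
  \<open>P\<close> of degree at most \<open>Suc m\<close> makes up for; the two cross terms
  contribute equally. The quadratic term has degree at most \<open>d + d\<close> and reaches
  \<open>m + d\<close> only for \<open>d = m\<close>.\<close>

lemma defect_add_monom:
  fixes P g :: "real poly" and c :: real and d m :: nat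
  assumes P: "degree P \<le> Suc m" and g: "degree g \<le> m" and d: "d \<le> m"
  defines "q \<equiv> defect P (g + monom c d) - defect P g"
  shows "degree q \<le> m + d"
    and "coeff q (m + d) = c * (real d * coeff P (Suc m) - 2 * coeff g m - (if d = m then c else 0))"
proof -
  define h where "h = monom c d"
  have h: "degree h \<le> d" "coeff h d = c"
    by (simp_all add: h_def degree_monom_le)
  have q: "q = (shift h - h) * shift P - (h * shift g + g * shift h) - h * shift h"
    by (simp add: q_def defect_add h_def)
  have 1: "degree ((shift h - h) * shift P) \<le> m + d \<and>
      coeff ((shift h - h) * shift P) (m + d) = c * real d * coeff P (Suc m)"
  proof (cases d)
    case 0
    then show ?thesis by (simp add: h_def monom_0)
  next
    case (Suc e)
    have "degree ((shift h - h) * shift P) \<le> e + Suc m"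
      using diff_shift_monom_Suc(1)[of c e] P Suc
      by (intro order.trans[OF degree_mult_le] add_mono) (simp_all add: h_def degree_shift)
    moreover have "coeff ((shift h - h) * shift P) (e + Suc m) =
        coeff (shift h - h) e * coeff (shift P) (Suc m)"
      using diff_shift_monom_Suc(1)[of c e] P Suc
      by (intro coeff_mult_degree_le_sum) (simp_all add: h_def degree_shift)
    ultimately show ?thesis
      using diff_shift_monom_Suc(2)[of c e] P Suc
      by (simp add: h_def coeff_shift_top add.commute)
  qed
  have 2: "degree (h * shift g) \<le> m + d" "coeff (h * shift g) (m + d) = c * coeff g m"
    using degree_mult_le[of h "shift g"] coeff_mult_degree_le_sum[of h d "shift g" m] h g
    by (simp_all add: degree_shift coeff_shift_top add.commute)
  have 3: "degree (g * shift h) \<le> m + d" "coeff (g * shift h) (m + d) = coeff g m * c"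
    using degree_mult_le[of g "shift h"] coeff_mult_degree_le_sum[of g m "shift h" d] h g
    by (simp_all add: degree_shift coeff_shift_top)
  have 4: "degree (h * shift h) \<le> d + d"
    using degree_mult_le[of h "shift h"] h by (simp add: degree_shift)
  have 5: "coeff (h * shift h) (m + d) = (if d = m then c * c else 0)"
    using coeff_mult_degree_le_sum[of h d "shift h" d] h 4 d
    by (auto simp: degree_shift coeff_shift_top intro!: coeff_eq_0)
  show "degree q \<le> m + d"
    unfolding q using 1 2 3 4 d by (intro degree_diff_le degree_add_le) auto
  show "coeff q (m + d) =
      c * (real d * coeff P (Suc m) - 2 * coeff g m - (if d = m then c else 0))"
    unfolding q using 1 2 3 5 by (simp add: algebra_simps)
qed

text \<open>The choice of the coefficient of index \<open>d\<close> is used to kill the coefficient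
  of index \<open>m + d\<close> in the defect. Going downwards, later choices leave the higher
  coefficients of the defect untouched.\<close>

lemma ex_small_defect:
  fixes P :: "real poly"
  assumes P: "degree P = Suc m" and m: "m > 0" and lc: "lead_coeff P > 0"
  shows "\<exists>g. degree g \<le> m \<and> coeff g m = real m * lead_coeff P \<and>
           (\<forall>i\<ge>m. coeff (defect P g) i = 0)"
proof -
  define a where "a = coeff P (Suc m)"
  have a: "a > 0" using lc P by (simp add: a_def)
  \<comment> \<open>\<open>r\<close> counts the coefficients chosen below the leading one;
    \<open>r = m\<close> is the claim.\<close>
  have "\<exists>g. degree g \<le> m \<and> coeff g m = real m * a \<and> (\<forall>i\<ge>m + (m - r). coeff (defect P g) i = 0)"
    if "r \<le> m" for r
    using that
  proof (induction r)
    case 0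
    \<comment> \<open>For a single monomial with coefficient \<open>c\<close>, the coefficient of
      index \<open>m + m\<close> in the defect is \<open>c * (real m * a - c)\<close>; this is its
      nonzero root.\<close>
    let ?g = "monom (real m * a) m"
    have "degree (defect P ?g) \<le> m + m" "coeff (defect P ?g) (m + m) = 0"
      using defect_add_monom[of P m 0 m "real m * a"] P
      by (simp_all add: defect_0 a_def)
    then have "coeff (defect P ?g) i = 0" if "i \<ge> m + m" for i
      using that by (cases "i = m + m") (auto intro: coeff_eq_0)
    then show ?case
      by (intro exI[of _ ?g]) (simp add: degree_monom_le)
  next
    case (Suc r)
    then obtain g where g: "degree g \<le> m" "coeff g m = real m * a"
      and D: "\<And>i. i \<ge> m + (m - r) \<Longrightarrow> coeff (defect P g) i = 0" by auto
    define d where "d = m - Suc r"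
    have d: "d < m" "m - r = Suc d" using Suc.prems by (auto simp: d_def)
    \<comment> \<open>For \<open>d < m\<close> the condition on the new coefficient is linear. Its
      slope is \<open>t\<close>, negative because \<open>real d < 2 * real m\<close>.\<close>
    define t where "t = (real d - 2 * real m) * a"
    have "t \<noteq> 0" using a d by (simp add: t_def)
    define c where "c = - coeff (defect P g) (m + d) / t"
    let ?g = "g + monom c d"
    let ?q = "defect P ?g - defect P g"
    have q: "degree ?q \<le> m + d" "coeff ?q (m + d) = c * t"
      using defect_add_monom[of P m g d c] P g d
      by (simp_all add: t_def a_def algebra_simps)
    have "coeff (defect P ?g) i = 0" if "i \<ge> m + d" for i
    proof (cases "i = m + d")
      case True
      then show ?thesis
        using q(2) \<open>t \<noteq> 0\<close> by (simp add: c_def)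
    next
      case False
      then have "i > m + d" using that by simp
      then have "coeff ?q i = 0" "coeff (defect P g) i = 0"
        using coeff_eq_0[of ?q i] q(1) D[of i] d by simp_all
      then show ?thesis by simp
    qed
    moreover have "degree ?g \<le> m"
      using g d by (intro degree_add_le) (auto intro: order.trans[OF degree_monom_le])
    ultimately show ?case
      using g d by (intro exI[of _ ?g]) (simp add: d_def)
  qed
  from this[of m] show ?thesis
    using P by (simp add: a_def)
qed

section \<open>Telescoping comparison of tails\<close>

lemma suminf_less_telescope:
  fixes x u :: "nat \<Rightarrow> real"
  assumes "u \<longlonglongrightarrow> 0" "\<And>j. 0 \<le> x j" "\<And>j. x j < u j - u (Suc j)"
  shows "summable x" and "suminf x < u 0"
proof -
  have u: "(\<lambda>j. u j - u (Suc j)) sums u 0"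
    using telescope_sums'[OF assms(1)] by simp
  show x: "summable x"
    by (rule summable_comparison_test'[OF sums_summable[OF u], of 0])
      (use assms(2,3) in \<open>auto intro: less_imp_le\<close>)
  have "0 < (\<Sum>j. (u j - u (Suc j)) - x j)"
    using assms(3) by (intro suminf_pos summable_diff sums_summable[OF u] x) simp
  then show "suminf x < u 0"
    using suminf_diff[OF sums_summable[OF u] x] sums_unique[OF u] by simp
qed

text \<open>The terms of \<open>x\<close> are bounded only from below here, which cannot yield
  convergence, so summability is a premise.\<close>

lemma suminf_greater_telescope:
  fixes x u :: "nat \<Rightarrow> real"
  assumes "u \<longlonglongrightarrow> 0" "summable x" "\<And>j. u j - u (Suc j) < x j"
  shows "u 0 < suminf x"
proof -
  have u: "(\<lambda>j. u j - u (Suc j)) sums u 0"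
    using telescope_sums'[OF assms(1)] by simp
  have "0 < (\<Sum>j. x j - (u j - u (Suc j)))"
    using assms(3) by (intro suminf_pos summable_diff sums_summable[OF u] assms(2)) simp
  then show ?thesis
    using suminf_diff[OF assms(2) sums_summable[OF u]] sums_unique[OF u] by simp
qed

lemma tendsto_inverse_poly:
  fixes g :: "real poly"
  assumes "degree g > 0" "lead_coeff g > 0"
  shows "(\<lambda>j. 1 / poly g (y + real j)) \<longlonglongrightarrow> 0"
proof -
  have "filterlim (\<lambda>j. y + real j) at_top sequentially"
    by (rule filterlim_tendsto_add_at_top[OF tendsto_const filterlim_real_sequentially])
  then have "filterlim (\<lambda>j. poly g (y + real j)) at_top sequentially"
    by (rule filterlim_compose[OF filterlim_poly_at_top[OF assms]])
  then show ?thesis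
    using tendsto_inverse_0_at_top by (auto simp: inverse_eq_divide)
qed

lemma eventually_tail_less:
  fixes P g :: "real poly"
  assumes P: "\<forall>\<^sub>F y in at_top. poly P y > 0" and g: "degree g > 0" "lead_coeff g > 0"
    and D: "\<forall>\<^sub>F y in at_top. poly (defect P g) y > 0"
  shows "\<forall>\<^sub>F y in at_top. poly g y > 0 \<and> summable (\<lambda>j. 1 / poly P (y + real (Suc j))) \<and>
           (\<Sum>j. 1 / poly P (y + real (Suc j))) < 1 / poly g y"
proof -
  have "\<forall>\<^sub>F y in at_top. poly P y > 0 \<and> poly g y > 0 \<and> poly (defect P g) y > 0"
    using P D eventually_poly_pos[of g "degree g"] g by (simp add: eventually_conj_iff)
  then obtain b where b: "\<And>y. y \<ge> b \<Longrightarrow> poly P y > 0"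
    "\<And>y. y \<ge> b \<Longrightarrow> poly g y > 0" "\<And>y. y \<ge> b \<Longrightarrow> poly (defect P g) y > 0"
    unfolding eventually_at_top_linorder by blast
  \<comment> \<open>This is positivity of the defect at \<open>z\<close>, divided by the positive
    product of \<open>poly g z\<close>, \<open>poly g (z + 1)\<close> and
    \<open>poly P (z + 1)\<close>.\<close>
  have step: "1 / poly P (z + 1) < 1 / poly g z - 1 / poly g (z + 1)" if "z \<ge> b" for z
    using b(1)[of "z + 1"] b(2)[of z] b(2)[of "z + 1"] b(3)[of z] that
    by (simp add: poly_defect field_simps)
  show ?thesis
    unfolding eventually_at_top_linorder
  proof (intro exI[of _ b] allI impI)
    fix y assume y: "y \<ge> b"
    let ?u = "\<lambda>j. 1 / poly g (y + real j)"
    have "0 \<le> 1 / poly P (y + real (Suc j))" for j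
      using b(1)[of "y + real (Suc j)"] y by simp
    moreover have "1 / poly P (y + real (Suc j)) < ?u j - ?u (Suc j)" for j
      using step[of "y + real j"] y by (simp add: add_ac)
    ultimately show "poly g y > 0 \<and> summable (\<lambda>j. 1 / poly P (y + real (Suc j))) \<and>
        (\<Sum>j. 1 / poly P (y + real (Suc j))) < 1 / poly g y"
      using suminf_less_telescope[OF tendsto_inverse_poly[OF g, of y],
          of "\<lambda>j. 1 / poly P (y + real (Suc j))"] b(2)[OF y]
      by simp
  qed
qed

text \<open>The summability required here is delivered by \<open>eventually_tail_less\<close>,
  applied to a different polynomial.\<close>

lemma eventually_tail_greater:
  fixes P g :: "real poly"
  assumes P: "\<forall>\<^sub>F y in at_top. poly P y > 0" and g: "degree g > 0" "lead_coeff g > 0"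
    and D: "\<forall>\<^sub>F y in at_top. poly (defect P g) y < 0"
  shows "\<forall>\<^sub>F y in at_top. summable (\<lambda>j. 1 / poly P (y + real (Suc j))) \<longrightarrow>
           poly g y > 0 \<and> 1 / poly g y < (\<Sum>j. 1 / poly P (y + real (Suc j)))"
proof -
  have "\<forall>\<^sub>F y in at_top. poly P y > 0 \<and> poly g y > 0 \<and> poly (defect P g) y < 0"
    using P D eventually_poly_pos[of g "degree g"] g by (simp add: eventually_conj_iff)
  then obtain b where b: "\<And>y. y \<ge> b \<Longrightarrow> poly P y > 0"
    "\<And>y. y \<ge> b \<Longrightarrow> poly g y > 0" "\<And>y. y \<ge> b \<Longrightarrow> poly (defect P g) y < 0"
    unfolding eventually_at_top_linorder by blast
  have step: "1 / poly g z - 1 / poly g (z + 1) < 1 / poly P (z + 1)" if "z \<ge> b" for z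
    using b(1)[of "z + 1"] b(2)[of z] b(2)[of "z + 1"] b(3)[of z] that
    by (simp add: poly_defect field_simps)
  show ?thesis
    unfolding eventually_at_top_linorder
  proof (intro exI[of _ b] allI impI)
    fix y assume y: "y \<ge> b" and s: "summable (\<lambda>j. 1 / poly P (y + real (Suc j)))"
    let ?u = "\<lambda>j. 1 / poly g (y + real j)"
    have "?u j - ?u (Suc j) < 1 / poly P (y + real (Suc j))" for j
      using step[of "y + real j"] y by (simp add: add_ac)
    then show "poly g y > 0 \<and> 1 / poly g y < (\<Sum>j. 1 / poly P (y + real (Suc j)))"
      using suminf_greater_telescope[OF tendsto_inverse_poly[OF g, of y] s] b(2)[OF y]
      by simp
  qed
qed

section \<open>Existence\<close>

lemma ex_approximates_recip_tails:
  fixes P :: "real poly"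
  assumes P: "degree P = Suc m" and m: "m > 0" and lc: "lead_coeff P > 0"
  shows "\<exists>f. degree f = m \<and> approximates_recip_tails P f"
proof -
  obtain g where g: "degree g \<le> m" "coeff g m = real m * lead_coeff P"
    and D: "\<And>i. i \<ge> m \<Longrightarrow> coeff (defect P g) i = 0"
    using ex_small_defect[OF assms] by blast
  have gm: "coeff g m > 0" using g m lc by simp
  have cd: "coeff (g + [:e:]) m = coeff g m" "degree (g + [:e:]) = m" for e
  proof -
    show c: "coeff (g + [:e:]) m = coeff g m"
      using m by (simp add: coeff_pCons split: nat.splits)
    show "degree (g + [:e:]) = m"
      using c gm g(1) by (intro antisym le_degree degree_add_le) simp_all
  qed
  \<comment> \<open>The case \<open>d = 0\<close> of \<open>defect_add_monom\<close>: the term with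
    \<open>P\<close> drops out, and the quadratic one too because \<open>m > 0\<close>.\<close>
  have De: "degree (defect P (g + [:e:])) \<le> m"
    "coeff (defect P (g + [:e:])) m = - 2 * e * coeff g m" for e
  proof -
    let ?q = "defect P (g + [:e:]) - defect P g"
    have q: "degree ?q \<le> m" "coeff ?q m = - 2 * e * coeff g m"
      using defect_add_monom[of P m g 0 e] P g m by (simp_all add: monom_0)
    then show "coeff (defect P (g + [:e:])) m = - 2 * e * coeff g m"
      using D[of m] by simp
    show "degree (defect P (g + [:e:])) \<le> m"
    proof (rule degree_le, intro allI impI)
      fix i assume "m < i"
      then have "coeff ?q i = 0" "coeff (defect P g) i = 0"
        using coeff_eq_0[of ?q i] q(1) D[of i] by simp_all
      then show "coeff (defect P (g + [:e:])) i = 0" by simp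
    qed
  qed
  \<comment> \<open>The two constants have opposite signs, hence so do the leading coefficients of
    the two defects, and they differ by exactly 1.\<close>
  define f where "f = g + [:-1/2:]"
  define f' where "f' = g + [:1/2:]"
  have f': "poly f' y = poly f y + 1" for y
    by (simp add: f_def f'_def)
  have Ppos: "\<forall>\<^sub>F y in at_top. poly P y > 0"
    using eventually_poly_pos[of P "degree P"] lc by simp
  have "\<forall>\<^sub>F y in at_top. poly (defect P f) y > 0"
    using De[of "-1/2"] gm unfolding f_def by (intro eventually_poly_pos[of _ m]) simp_all
  then have less: "\<forall>\<^sub>F y in at_top. poly f y > 0 \<and> summable (\<lambda>j. 1 / poly P (y + real (Suc j))) \<and>
      (\<Sum>j. 1 / poly P (y + real (Suc j))) < 1 / poly f y"
    using m gm unfolding f_def by (intro eventually_tail_less Ppos) (simp_all only: cd)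
  have "\<forall>\<^sub>F y in at_top. poly (- defect P f') y > 0"
    using De[of "1/2"] gm unfolding f'_def by (intro eventually_poly_pos[of _ m]) simp_all
  then have "\<forall>\<^sub>F y in at_top. poly (defect P f') y < 0" by simp
  then have greater: "\<forall>\<^sub>F y in at_top. summable (\<lambda>j. 1 / poly P (y + real (Suc j))) \<longrightarrow>
      poly f' y > 0 \<and> 1 / poly f' y < (\<Sum>j. 1 / poly P (y + real (Suc j)))"
    using m gm unfolding f'_def by (intro eventually_tail_greater Ppos) (simp_all only: cd)
  have "\<forall>\<^sub>F y in at_top. poly f y < 1 / (\<Sum>j. 1 / poly P (y + real (Suc j))) \<and>
      1 / (\<Sum>j. 1 / poly P (y + real (Suc j))) < poly f y + 1"
    using less greater
  proof eventually_elim
    case (elim y)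
    let ?S = "\<Sum>j. 1 / poly P (y + real (Suc j))"
    have *: "poly f y > 0" "?S < 1 / poly f y" "poly f' y > 0" "1 / poly f' y < ?S"
      using elim by auto
    \<comment> \<open>Positivity of the sum allows both inequalities to be inverted.\<close>
    then have "?S > 0" by (meson divide_pos_pos less_trans zero_less_one)
    with * show ?case
      by (simp add: f' field_simps)
  qed
  then obtain b where b: "\<And>y. y \<ge> b \<Longrightarrow> poly f y < 1 / (\<Sum>j. 1 / poly P (y + real (Suc j))) \<and>
      1 / (\<Sum>j. 1 / poly P (y + real (Suc j))) < poly f y + 1"
    unfolding eventually_at_top_linorder by blast
  have "approximates_recip_tails P f"
    unfolding approximates_recip_tails_def
  proof (intro allI impI)
    fix a :: real
    \<comment> \<open>The tail after index \<open>n\<close> is the sum studied above at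
      \<open>y = real n + a\<close>. As \<open>b\<close> does not depend on \<open>a\<close>, one
      \<open>f\<close> serves every base point, and only the threshold for \<open>n\<close>
      moves.\<close>
    have eq: "(\<lambda>j. recip_seq P a (n + 1 + j)) = (\<lambda>j. 1 / poly P (real n + a + real (Suc j)))" for n
      by (simp add: recip_seq_def fun_eq_iff add_ac)
    show "\<exists>N\<^sub>0::int. \<forall>n::nat. int n \<ge> N\<^sub>0 \<longrightarrow>
          poly f (real n + a) < 1 / (\<Sum>j. recip_seq P a (n + 1 + j)) \<and>
          1 / (\<Sum>j. recip_seq P a (n + 1 + j)) < poly f (real n + a) + 1"
      unfolding eq
    proof (intro exI[of _ "\<lceil>b - a\<rceil>"] allI impI b)
      fix n :: nat assume "\<lceil>b - a\<rceil> \<le> int n"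
      then show "b \<le> real n + a" by linarith
    qed
  qed
  then show ?thesis
    using cd(2) unfolding f_def by blast
qed

section \<open>Uniqueness up to a constant\<close>

lemma approximates_recip_tails_unique:
  fixes P :: "real poly"
  assumes lc: "lead_coeff P > 0"
    and f: "approximates_recip_tails P f" and g: "approximates_recip_tails P g"
  shows "degree (f - g) = 0"
proof -
  have "\<forall>\<^sub>F y in at_top. poly P y > 0"
    using eventually_poly_pos[of P "degree P"] lc by simp
  \<comment> \<open>The property speaks only about admissible base points; one of them suffices for
    comparing \<open>f\<close> and \<open>g\<close>.\<close>
  then obtain a where a: "\<forall>x>a. poly P x > 0"
    unfolding eventually_at_top_linorder by (meson less_imp_le)
  obtain M N :: int where
    M: "\<And>n. int n \<ge> M \<Longrightarrow> poly f (real n + a) < 1 / (\<Sum>j. recip_seq P a (n + 1 + j)) \<and>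
          1 / (\<Sum>j. recip_seq P a (n + 1 + j)) < poly f (real n + a) + 1" and
    N: "\<And>n. int n \<ge> N \<Longrightarrow> poly g (real n + a) < 1 / (\<Sum>j. recip_seq P a (n + 1 + j)) \<and>
          1 / (\<Sum>j. recip_seq P a (n + 1 + j)) < poly g (real n + a) + 1"
    using f g a unfolding approximates_recip_tails_def by meson
  \<comment> \<open>The same number lies strictly between \<open>f\<close> and \<open>f + 1\<close>
    and between \<open>g\<close> and \<open>g + 1\<close>.\<close>
  have "\<bar>poly (f - g) (real n + a)\<bar> < 1" if "n \<ge> nat (max M N)" for n
  proof -
    have "int n \<ge> M" "int n \<ge> N" using that by auto
    from M[OF this(1)] N[OF this(2)] show ?thesis
      unfolding poly_diff abs_less_iff by linarith
  qed
  then show ?thesis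
    by (intro degree_eq_0_if_abs_bounded[of _ a 1]) (auto simp: eventually_sequentially)
qed

theorem theorem1p2:
  fixes P :: "real poly" and k :: nat
  assumes "degree P = k" and "k \<ge> 2" and "lead_coeff P > 0"
  shows "(\<exists>f :: real poly. degree f = k - 1 \<and> approximates_recip_tails P f) \<and>
         (\<forall>f g :: real poly.
            degree f = k - 1 \<and> approximates_recip_tails P f \<and>
            degree g = k - 1 \<and> approximates_recip_tails P g \<longrightarrow>
            (\<exists>c::real. f - g = [:c:]))"
proof (intro conjI allI impI)
  show "\<exists>f. degree f = k - 1 \<and> approximates_recip_tails P f"
    using assms by (intro ex_approximates_recip_tails) auto
next
  fix f g :: "real poly"
  assume "degree f = k - 1 \<and> approximates_recip_tails P f \<and>
          degree g = k - 1 \<and> approximates_recip_tails P g"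
  then have "degree (f - g) = 0"
    using assms(3) by (intro approximates_recip_tails_unique) auto
  then show "\<exists>c. f - g = [:c:]"
    by (rule degree_eq_zeroE) blast
qed

end
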